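(* Let $n\geq 1$. A simplicial complex $K$ on $I_n$ is a minimal complex generating $\mathsf{Mon}_n$ and contains exactly one $(n-1)$-interval as a simplex if and only if $K$ is a member of the $K_5$ family, i.e. $n\geq 5$ and $K$ is the image, under some circular permutation $x\mapsto x+c\bmod n$ of $I_n$, of a complex $$K^n_{i,j}=\langle [\![1,n-1]\!],\ [\![0,j-1]\!],\ [\![j+1,i-1]\!],\ [\![i+1,0]\!]\rangle$$ for some integers $i,j$ with $1<i<j<n-1$.
   Context: For finite sets $A,I$, a language is a subset $L\subseteq A^I$. For finite sets $B,J$ and a function $f:B^J\to A^I$, the input window $\mathcal{W}_f(i)\subseteq J$ of $i\in I$ is the smallest $W\subseteq J$ such that for all $x,y\in B^J$ agreeing on $W$, $f(x)_i=f(y)_i$. The communication complex $K_f$ is the simplicial complex on vertex set $I$ whose simplices are the sets $S\subseteq I$ with $\bigcap_{i\in S}\mathcal{W}_f(i)\neq\emptyset$. A simplicial complex $K$ on $I$ generates $L$ if there exist finite sets $B,J$ and $f:B^J\to A^I$ with $f(B^J)=L$ and $K_f\subseteq K$; $K$ is minimal generating $L$ if it generates $L$ and no complex properly contained in $K$ generates $L$. $\mathsf{Mon}_n\subseteq\{0,1\}^n$ is the set of binary strings $x_0\ldots x_{n-1}$ that are non-decreasing or non-increasing. Positions $I_n=\{0,\ldots,n-1\}$ are identified with $\mathbb{Z}/n\mathbb{Z}$. For $a,b\in\mathbb{Z}$, the interval $[\![a,b]\!]=\{c\bmod n: c\in\mathbb{Z},\ a\leq c\leq b'\}$ where $b'$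 is the representative of $b$ modulo $n$ with $a\leq b'<a+n$; its size is $1+((b-a)\bmod n)$, and a $k$-interval is an interval of size $k$. $\langle S_0,\ldots,S_k\rangle$ denotes the simplicial complex whose maximal simplices are $S_0,\ldots,S_k$. The image of a complex $K$ under a permutation $\sigma$ of $I_n$ is $\{\sigma(S):S\in K\}$. *)

theory Defs
  imports Main "HOL-Library.FuncSet"
begin

text \<open>\<open>B\<^sup>J\<close> is rendered as \<open>J \<rightarrow>\<^sub>E B\<close>, the functions from \<open>J\<close> to \<open>B\<close> that take the default value
  outside \<open>J\<close>.\<close>

definition depends_only_on ::
  "'b set \<Rightarrow> 'j set \<Rightarrow> (('j \<Rightarrow> 'b) \<Rightarrow> ('i \<Rightarrow> 'a)) \<Rightarrow> 'i \<Rightarrow> 'j set \<Rightarrow> bool" where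
  "depends_only_on B J f i W \<longleftrightarrow>
     W \<subseteq> J \<and> (\<forall>x \<in> J \<rightarrow>\<^sub>E B. \<forall>y \<in> J \<rightarrow>\<^sub>E B. (\<forall>j\<in>W. x j = y j) \<longrightarrow> f x i = f y i)"

definition input_window ::
  "'b set \<Rightarrow> 'j set \<Rightarrow> (('j \<Rightarrow> 'b) \<Rightarrow> ('i \<Rightarrow> 'a)) \<Rightarrow> 'i \<Rightarrow> 'j set" where
  "input_window B J f i = (LEAST W. depends_only_on B J f i W)"

lemma depends_only_on_Int:
  assumes V: "depends_only_on B J f i V" and W: "depends_only_on B J f i W"
  shows "depends_only_on B J f i (V \<inter> W)"
  unfolding depends_only_on_def
proof (intro conjI ballI impI)
  show "V \<inter> W \<subseteq> J" using V by (auto simp: depends_only_on_def)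
next
  fix x y assume x: "x \<in> J \<rightarrow>\<^sub>E B" and y: "y \<in> J \<rightarrow>\<^sub>E B" and eq: "\<forall>j\<in>V \<inter> W. x j = y j"
  define z where "z = (\<lambda>j. if j \<in> V then x j else y j)"
  have VJ: "V \<subseteq> J" using V by (simp add: depends_only_on_def)
  have z: "z \<in> J \<rightarrow>\<^sub>E B" using x y VJ by (auto simp: z_def PiE_iff extensional_def)
  have "\<forall>j\<in>V. x j = z j" by (simp add: z_def)
  then have "f x i = f z i" using V x z unfolding depends_only_on_def by blast
  also have "f z i = f y i"
  proof -
    have "\<forall>j\<in>W. z j = y j" using eq by (simp add: z_def)
    then show ?thesis using W y z unfolding depends_only_on_def by blast
  qed
  finally show "f x i = f y i" .
qed

text \<open>For finite \<open>J\<close> a smallest such set exists.\<close>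

lemma input_window_least:
  assumes "finite J"
  shows "depends_only_on B J f i (input_window B J f i)"
    and "depends_only_on B J f i W \<Longrightarrow> input_window B J f i \<subseteq> W"
proof -
  let ?F = "{W. depends_only_on B J f i W}"
  have fin: "finite ?F"
    by (rule finite_subset[of _ "Pow J"]) (auto simp: depends_only_on_def assms)
  have "x = y" if "x \<in> J \<rightarrow>\<^sub>E B" "y \<in> J \<rightarrow>\<^sub>E B" "\<forall>j\<in>J. x j = y j" for x y
    using that by (intro PiE_ext[of x J "\<lambda>_. B" y]) auto
  then have J: "J \<in> ?F" unfolding depends_only_on_def by blast
  have Int: "\<Inter>G \<in> ?F" if "finite G" "G \<noteq> {}" "G \<subseteq> ?F" for G
    using that by (induction G rule: finite_ne_induct) (auto intro: depends_only_on_Int)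
  have "\<Inter>?F \<in> ?F" using Int[of ?F] fin J by blast
  then have "depends_only_on B J f i (\<Inter>?F)" by simp
  moreover have "\<Inter>?F \<subseteq> V" if "depends_only_on B J f i V" for V using that by blast
  ultimately have eq: "input_window B J f i = \<Inter>?F"
    unfolding input_window_def by (intro Least_equality) auto
  show "depends_only_on B J f i (input_window B J f i)"
    using \<open>depends_only_on B J f i (\<Inter>?F)\<close> eq by simp
  show "depends_only_on B J f i W \<Longrightarrow> input_window B J f i \<subseteq> W" using eq by blast
qed

text \<open>The empty simplex belongs to every complex. Elements of \<open>I\<close> need not be vertices: in the
  communication complex of \<open>f\<close>, a position at which \<open>f\<close> is constant is not one.\<close>

definition simplicial_complex_on :: "'i set \<Rightarrow> 'i set set \<Rightarrow> bool" where
  "simplicial_complex_on I K \<longleftrightarrow>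
     K \<subseteq> Pow I \<and> {} \<in> K \<and> (\<forall>S\<in>K. \<forall>T. T \<subseteq> S \<longrightarrow> T \<in> K)"

definition communication_complex ::
  "'i set \<Rightarrow> 'b set \<Rightarrow> 'j set \<Rightarrow> (('j \<Rightarrow> 'b) \<Rightarrow> ('i \<Rightarrow> 'a)) \<Rightarrow> 'i set set" where
  "communication_complex I B J f =
     {S. S \<subseteq> I \<and> (S = {} \<or> (\<Inter>i\<in>S. input_window B J f i) \<noteq> {})}"

lemma simplicial_complex_on_communication_complex:
  "simplicial_complex_on I (communication_complex I B J f)"
  unfolding simplicial_complex_on_def communication_complex_def by blast

text \<open>Only the cardinalities of the finite sets \<open>B\<close> and \<open>J\<close> matter, so they are taken to be sets of
  natural numbers. The language \<open>L\<close> is meant to be a subset of \<open>I \<rightarrow>\<^sub>E A\<close> for some finite \<open>A\<close>; that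
  \<open>f\<close> maps into \<open>I \<rightarrow>\<^sub>E A\<close> then follows from the equation for its image.\<close>

definition generates :: "'i set \<Rightarrow> 'i set set \<Rightarrow> ('i \<Rightarrow> 'a) set \<Rightarrow> bool" where
  "generates I K L \<longleftrightarrow>
     (\<exists>(B :: nat set) (J :: nat set) f. finite B \<and> finite J \<and>
        f ` (J \<rightarrow>\<^sub>E B) = L \<and> communication_complex I B J f \<subseteq> K)"

definition minimal_generating :: "'i set \<Rightarrow> 'i set set \<Rightarrow> ('i \<Rightarrow> 'a) set \<Rightarrow> bool" where
  "minimal_generating I K L \<longleftrightarrow>
     simplicial_complex_on I K \<and> generates I K L \<and>
     (\<forall>K'. simplicial_complex_on I K' \<and> K' \<subset> K \<longrightarrow> \<not> generates I K' L)"

text \<open>Positions are integers, so that arithmetic modulo \<open>n\<close> involves no truncated subtraction.\<close>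

definition positions :: "nat \<Rightarrow> int set" where
  "positions n = {0..<int n}"

definition Mon :: "nat \<Rightarrow> (int \<Rightarrow> nat) set" where
  "Mon n = {x \<in> positions n \<rightarrow>\<^sub>E {0, 1}. mono_on (positions n) x \<or> antimono_on (positions n) x}"

text \<open>\<open>a + (b - a) mod n\<close> is the representative \<open>b'\<close> of \<open>b\<close> modulo \<open>n\<close> with \<open>a \<le> b' < a + n\<close>.\<close>

definition cyclic_interval :: "nat \<Rightarrow> int \<Rightarrow> int \<Rightarrow> int set" where
  "cyclic_interval n a b = {c mod int n | c. a \<le> c \<and> c \<le> a + (b - a) mod int n}"

definition is_k_interval :: "nat \<Rightarrow> nat \<Rightarrow> int set \<Rightarrow> bool" where
  "is_k_interval n k S \<longleftrightarrow> (\<exists>a b. S = cyclic_interval n a b) \<and> card S = k"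

lemma card_cyclic_interval:
  assumes "n \<ge> 1"
  shows "int (card (cyclic_interval n a b)) = 1 + (b - a) mod int n"
proof -
  let ?d = "(b - a) mod int n"
  have d: "0 \<le> ?d" "?d < int n" using assms by auto
  have eq: "cyclic_interval n a b = (\<lambda>c. c mod int n) ` {a..a + ?d}"
    unfolding cyclic_interval_def by auto
  have "inj_on (\<lambda>c. c mod int n) {a..a + ?d}"
  proof (rule inj_onI)
    fix x y assume xy: "x \<in> {a..a + ?d}" "y \<in> {a..a + ?d}" "x mod int n = y mod int n"
    then have "int n dvd x - y" by (simp add: mod_eq_dvd_iff)
    moreover have "\<bar>x - y\<bar> < int n" using xy d by auto
    ultimately show "x = y" using zdvd_imp_le[of "int n" "\<bar>x - y\<bar>"] by fastforce
  qed
  then show ?thesis using d by (simp add: eq card_image)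
qed

definition complex_generated_by :: "'i set set \<Rightarrow> 'i set set" where
  "complex_generated_by F = {S. \<exists>T\<in>F. S \<subseteq> T}"

text \<open>If no member of \<open>F\<close> contains another one, the maximal simplices of
  \<open>complex_generated_by F\<close> are exactly the members of \<open>F\<close>.\<close>

lemma maximal_simplices_complex_generated_by:
  assumes "\<And>S T. S \<in> F \<Longrightarrow> T \<in> F \<Longrightarrow> S \<subseteq> T \<Longrightarrow> S = T"
  shows "{S \<in> complex_generated_by F. \<forall>T \<in> complex_generated_by F. S \<subseteq> T \<longrightarrow> S = T} = F"
proof (intro equalityI subsetI)
  fix S assume "S \<in> {S \<in> complex_generated_by F. \<forall>T \<in> complex_generated_by F. S \<subseteq> T \<longrightarrow> S = T}"
  then show "S \<in> F" unfolding complex_generated_by_def by blast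
next
  fix S assume S: "S \<in> F"
  have "S = T" if T: "T \<in> complex_generated_by F" and ST: "S \<subseteq> T" for T
  proof -
    obtain U where U: "U \<in> F" "T \<subseteq> U" using T unfolding complex_generated_by_def by blast
    then have "S = U" using assms[OF S, of U] ST by blast
    then show ?thesis using U ST by blast
  qed
  then show "S \<in> {S \<in> complex_generated_by F. \<forall>T \<in> complex_generated_by F. S \<subseteq> T \<longrightarrow> S = T}"
    using S by (auto simp: complex_generated_by_def)
qed

definition K5_complex :: "nat \<Rightarrow> int \<Rightarrow> int \<Rightarrow> int set set" where
  "K5_complex n i j = complex_generated_by
     {cyclic_interval n 1 (int n - 1), cyclic_interval n 0 (j - 1),
      cyclic_interval n (j + 1) (i - 1), cyclic_interval n (i + 1) 0}"

definition complex_image :: "('i \<Rightarrow> 'i) \<Rightarrow> 'i set set \<Rightarrow> 'i set set" where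
  "complex_image \<sigma> K = (\<lambda>S. \<sigma> ` S) ` K"

definition circular_permutation :: "nat \<Rightarrow> int \<Rightarrow> int \<Rightarrow> int" where
  "circular_permutation n c x = (x + c) mod int n"

definition in_K5_family :: "nat \<Rightarrow> int set set \<Rightarrow> bool" where
  "in_K5_family n K \<longleftrightarrow> n \<ge> 5 \<and>
     (\<exists>c i j :: int. 1 < i \<and> i < j \<and> j < int n - 1 \<and>
        K = complex_image (circular_permutation n c) (K5_complex n i j))"

end

theory Submission imports Defs begin

text \<open>Let \<open>P s\<close> be the set of positions that do not read the source \<open>s\<close>. If the output has its break
  between \<open>k\<close> and \<open>k + 1\<close>, and one changes any sources whose sets \<open>P s\<close> have elements on both sides of
  this gap, then position \<open>0\<close> keeps its value. Hence if two gaps \<open>k, l\<close> pierced the convex hulls of all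
  \<open>P s\<close> with \<open>s\<close> read by \<open>0\<close>, one could mix an input for a word \<open>0\<dots>01\<dots>1\<close> broken at \<open>k\<close> with one for
  \<open>1\<dots>10\<dots>0\<close> broken at \<open>l\<close>, and position \<open>0\<close> would have to output both values. When no \<open>(n - 1)\<close>-interval
  other than the complement of \<open>0\<close> is a simplex, each hull contains a gap, and intervals that cannot be
  pierced by two points include three disjoint ones: these give the three simplices of \<open>K\<^sup>n\<^sub>i\<^sub>,\<^sub>j\<close>
  that contain \<open>0\<close>.

  The simplex missing only \<open>0\<close> cannot be removed from \<open>K\<^sup>n\<^sub>i\<^sub>,\<^sub>j\<close>: fix the sources not read by \<open>0\<close>;
  each position then follows a strategy in terms of the other sources, and whether position \<open>i\<close> is constantly
  \<open>v\<close> can be read off the strategy of any single position \<open>q > 0\<close>. If each source not read by \<open>0\<close> were also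
  missed by some \<open>q > 0\<close>, this would not depend on these sources at all, and some words would be lost.\<close>

section \<open>Monotone words\<close>

text \<open>Excluding the patterns 010 and 101 treats both directions at once and is symmetric under
  negation. For the converse, a descent from \<open>p\<close> to \<open>q\<close> forces 1 up to
  \<open>p\<close> and 0 from \<open>q\<close> on; an ascent would lie in between and create
  101.\<close>

lemma Mon_iff:
  "w \<in> Mon n \<longleftrightarrow> w \<in> positions n \<rightarrow>\<^sub>E {0, 1} \<and>
     (\<forall>a b c. 0 \<le> a \<and> a < b \<and> b < c \<and> c < int n \<and> w a = w c \<longrightarrow> w b = w a)"
    (is "_ \<longleftrightarrow> ?E \<and> ?T")
proof (intro iffI conjI)
  assume w: "w \<in> Mon n"
  then show ?E by (simp add: Mon_def)
  show ?T
  proof (intro allI impI, elim conjE)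
    fix a b c assume "0 \<le> a" "a < b" "b < c" "c < int n" "w a = w c"
    moreover from w consider "mono_on (positions n) w" | "antimono_on (positions n) w"
      by (auto simp: Mon_def)
    then have "w a \<le> w b \<and> w b \<le> w c \<or> w b \<le> w a \<and> w c \<le> w b"
    proof cases
      case 1
      then show ?thesis using calculation monotone_onD[OF 1, of a b] monotone_onD[OF 1, of b c]
        by (simp add: positions_def)
    next
      case 2
      then show ?thesis using calculation monotone_onD[OF 2, of a b] monotone_onD[OF 2, of b c]
        by (simp add: positions_def)
    qed
    ultimately show "w b = w a" by auto
  qed
next
  assume ET: "?E \<and> ?T"
  note E = conjunct1[OF ET] and T = conjunct2[OF ET]
  have 01: "w a = 0 \<or> w a = 1" if "a \<in> positions n" for a using PiE_mem[OF E that] by simp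
  show "w \<in> Mon n"
  proof (cases "mono_on (positions n) w")
    case True
    then show ?thesis using E by (simp add: Mon_def)
  next
    case False
    then obtain p q where pq: "p \<in> positions n" "q \<in> positions n" "p \<le> q" "w p > w q"
      by (auto simp: monotone_on_def not_le)
    then have pq': "p < q" "w p = 1" "w q = 0"
      using 01[of p] 01[of q] by (auto simp: order_less_le)
    have left: "w r = 1" if "0 \<le> r" "r \<le> p" for r
    proof (rule ccontr)
      assume "w r \<noteq> 1"
      then have "w r = w q" using 01[of r] that pq pq' by (auto simp: positions_def)
      moreover have "r < p" using \<open>w r \<noteq> 1\<close> that pq' by (cases "r = p") auto
      ultimately show False using T[rule_format, of r p q] that pq pq' by (auto simp: positions_def)
    qed
    have right: "w r = 0" if "q \<le> r" "r < int n" for r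
    proof (rule ccontr)
      assume "w r \<noteq> 0"
      then have "w r = w p" using 01[of r] that pq pq' by (auto simp: positions_def)
      moreover have "q < r" using \<open>w r \<noteq> 0\<close> that pq' by (cases "r = q") auto
      ultimately show False using T[rule_format, of p q r] that pq pq' by (auto simp: positions_def)
    qed
    have "w s \<le> w r" if rs: "r \<in> positions n" "s \<in> positions n" "r \<le> s" for r s
    proof (rule ccontr)
      assume "\<not> w s \<le> w r"
      then have v: "w r = 0" "w s = 1" using 01 rs by force+
      have "p < r" using left[of r] rs v by (force simp: positions_def)
      moreover have "s < q" using right[of s] rs v by (force simp: positions_def)
      ultimately show False using T[rule_format, of p r s] v pq' rs pq
        by (cases "r = s") (auto simp: positions_def)
    qed
    then have "antimono_on (positions n) w" by (auto simp: monotone_on_def)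
    then show ?thesis using E by (simp add: Mon_def)
  qed
qed

lemma Mon_between:
  "w \<in> Mon n \<Longrightarrow> 0 \<le> a \<Longrightarrow> a \<le> b \<Longrightarrow> b \<le> c \<Longrightarrow> c < int n \<Longrightarrow> w a = w c \<Longrightarrow> w b = w a"
  unfolding Mon_iff by (metis order_less_le)

lemma Mon_01: "w \<in> Mon n \<Longrightarrow> 0 \<le> a \<Longrightarrow> a < int n \<Longrightarrow> w a = 0 \<or> w a = 1"
  by (auto simp: Mon_def positions_def PiE_iff)

text \<open>With only two values, an earlier entry different from \<open>w a\<close> would equal
  \<open>w b\<close>, and \<open>a\<close> would lie between two equal entries.\<close>

lemma Mon_prefix:
  assumes "w \<in> Mon n" "0 \<le> a" "a < b" "b < int n" "w a \<noteq> w b" "0 \<le> p" "p \<le> a"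
  shows "w p = w a"
  using Mon_between[of w n p a b] Mon_01[of w n] assms
  by (smt (verit))

lemma Mon_suffix:
  assumes "w \<in> Mon n" "0 \<le> a" "a < b" "b < int n" "w a \<noteq> w b" "b \<le> p" "p < int n"
  shows "w p = w b"
  using Mon_between[of w n a b p] Mon_01[of w n] assms
  by (smt (verit))

text \<open>\<open>s\<close> is the value before the break. Any \<open>p\<close> below 0 or at least
  \<open>n - 1\<close> gives a constant word.\<close>

definition step_word :: "nat \<Rightarrow> bool \<Rightarrow> int \<Rightarrow> int \<Rightarrow> nat" where
  "step_word n s p = (\<lambda>k\<in>positions n. of_bool ((p < k) \<noteq> s))"

lemma step_word_Mon: "step_word n s p \<in> Mon n"
  unfolding Mon_iff by (auto simp: step_word_def positions_def of_bool_def)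

text \<open>The break goes at the end of the longest initial run of the value \<open>w 0\<close>;
  constant words get \<open>p = n - 1\<close>.\<close>

lemma Mon_step_word:
  assumes "n \<ge> 1" "w \<in> Mon n"
  obtains p s where "p \<in> positions n" "w = step_word n s p"
proof -
  define c where "c = w 0"
  define M where "M = {k \<in> positions n. \<forall>l\<in>{0..k}. w l = c}"
  have fin: "finite M" by (rule finite_subset[of _ "positions n"]) (auto simp: M_def positions_def)
  have "0 \<in> M" using assms by (simp add: M_def positions_def c_def)
  then have pM: "Max M \<in> M" using fin Max_in by blast
  define p where "p = Max M"
  have p: "p \<in> positions n" "\<And>l. 0 \<le> l \<Longrightarrow> l \<le> p \<Longrightarrow> w l = c"
    using pM[folded p_def] by (auto simp: M_def)
  have after: "w k \<noteq> c" if "p < k" "k < int n" for k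
  proof
    assume eq: "w k = c"
    have "w l = c" if "0 \<le> l" "l \<le> k" for l
      using Mon_between[OF assms(2), of 0 l k] eq that \<open>k < int n\<close> by (simp add: c_def)
    then have "k \<in> M" using that p(1) by (auto simp: M_def positions_def)
    from Max_ge[OF fin this] show False using that by (simp add: p_def)
  qed
  have "w k = step_word n (c = 1) p k" for k
  proof (cases "k \<in> positions n")
    case True
    then show ?thesis
      using p(2)[of k] after[of k] Mon_01[OF assms(2), of k] Mon_01[OF assms(2), of 0, folded c_def] assms(1)
      by (cases "p < k") (auto simp: step_word_def positions_def)
  next
    case False
    then show ?thesis using assms(2) by (auto simp: Mon_def step_word_def)
  qed
  then show ?thesis using that p(1) by blast
qed

text \<open>Rotations do not preserve \<^const>\<open>Mon\<close>; they do once the entries that wrap around are negated.\<close>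

definition twist :: "nat \<Rightarrow> int \<Rightarrow> (int \<Rightarrow> nat) \<Rightarrow> int \<Rightarrow> nat" where
  "twist n c w = (\<lambda>k\<in>positions n. if c \<le> k then w (k - c) else 1 - w (k - c + int n))"

text \<open>Extend \<open>w\<close> to the integers by negating after every \<open>n\<close> steps:
  the result has runs of length \<open>n\<close>, so each window of length \<open>n\<close> is
  monotone, and \<open>twist\<close> is such a window. The cases count how many of \<open>p\<close>,
  \<open>q\<close>, \<open>r\<close> wrap around.\<close>

lemma twist_Mon:
  assumes w: "w \<in> Mon n" and c: "0 \<le> c" "c \<le> int n"
  shows "twist n c w \<in> Mon n"
  unfolding Mon_iff
proof (intro conjI allI impI, goal_cases)
  case 1
  have "twist n c w k \<in> {0, 1}" if "k \<in> positions n" for k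
    using that c Mon_01[OF w, of "k - c"] Mon_01[OF w, of "k - c + int n"]
    by (auto simp: twist_def positions_def)
  then show ?case by (auto simp: PiE_iff twist_def)
next
  case (2 p q r)
  note T = Mon_between[OF w] and B = Mon_01[OF w]
  from 2 c consider "c \<le> p" | "p < c" "c \<le> q" | "q < c" "c \<le> r" | "r < c" by linarith
  then show ?case
  proof cases
    case 1
    then show ?thesis using 2 c T[of "p - c" "q - c" "r - c"] by (auto simp: twist_def positions_def)
  next
    case 2
    then show ?thesis
      using \<open>0 \<le> p \<and> _\<close> c T[of "q - c" "r - c" "p - c + int n"]
        B[of "q - c"] B[of "r - c"] B[of "p - c + int n"]
      by (auto simp: twist_def positions_def)
  next
    case 3
    then show ?thesis
      using \<open>0 \<le> p \<and> _\<close> c T[of "r - c" "p - c + int n" "q - c + int n"]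
        B[of "r - c"] B[of "p - c + int n"] B[of "q - c + int n"]
      by (auto simp: twist_def positions_def)
  next
    case 4
    then show ?thesis
      using 2 c T[of "p - c + int n" "q - c + int n" "r - c + int n"]
        B[of "p - c + int n"] B[of "q - c + int n"] B[of "r - c + int n"]
      by (auto simp: twist_def positions_def)
  qed
qed

text \<open>Twisting by \<open>n - c\<close> and then by \<open>c\<close> shifts by \<open>n\<close>
  in total, which negates the word; the inserted \<open>twist n (int n)\<close> is another negation
  and cancels it.\<close>

lemma twist_twist:
  assumes w: "w \<in> Mon n" and c: "0 \<le> c" "c \<le> int n"
  shows "twist n c (twist n (int n) (twist n (int n - c) w)) = w"
proof
  fix k
  show "twist n c (twist n (int n) (twist n (int n - c) w)) k = w k"
  proof (cases "k \<in> positions n")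
    case True
    then show ?thesis using c Mon_01[OF w, of k]
      by (auto simp: twist_def positions_def)
  next
    case False
    then show ?thesis using w by (auto simp: twist_def Mon_def)
  qed
qed

lemma twist_image: 
  assumes c: "0 \<le> c" "c \<le> int n"
  shows "twist n c ` Mon n = Mon n"
proof (intro equalityI subsetI)
  fix w assume w: "w \<in> Mon n"
  have "twist n (int n) (twist n (int n - c) w) \<in> Mon n"
    using c w by (intro twist_Mon) auto
  then show "w \<in> twist n c ` Mon n" using twist_twist[OF w c] by force
qed (use twist_Mon c in auto)

section \<open>Rotations\<close>

text \<open>Postcomposing with \<open>twist\<close> maps the language onto itself. Negating an
  output does not change what it reads, so position \<open>k\<close> of \<open>g\<close> reads no
  more than position \<open>\<tau> k\<close> of \<open>f\<close>.\<close>

lemma generates_circular_permutation: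
  assumes gen: "generates (positions n) K (Mon n)" and n: "n \<ge> 1"
  shows "generates (positions n) (complex_image (circular_permutation n c) K) (Mon n)"
proof -
  obtain B J :: "nat set" and f where fin: "finite B" "finite J"
    and im: "f ` (J \<rightarrow>\<^sub>E B) = Mon n" and cc: "communication_complex (positions n) B J f \<subseteq> K"
    using gen unfolding generates_def by blast
  define e where "e = c mod int n"
  have e: "0 \<le> e" "e < int n" using n by (auto simp: e_def)
  define g where "g = (\<lambda>x. twist n e (f x))"
  define \<tau> where "\<tau> = (\<lambda>k. (k - e) mod int n)"
  have \<tau>: "\<tau> k = (if e \<le> k then k - e else k - e + int n)" if "k \<in> positions n" for k
    using that e mod_add_self2[of "k - e" "int n"] by (auto simp: \<tau>_def positions_def simp del: mod_add_self2)
  have \<tau>_in: "\<tau> k \<in> positions n" if "k \<in> positions n" for k using n by (simp add: \<tau>_def positions_def)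
  have \<sigma>\<tau>: "circular_permutation n c (\<tau> k) = k" if "k \<in> positions n" for k
    using that by (simp add: circular_permutation_def \<tau>_def e_def positions_def mod_simps)
  have window: "input_window B J g k \<subseteq> input_window B J f (\<tau> k)" if k: "k \<in> positions n" for k
  proof (rule input_window_least(2)[OF fin(2)])
    have eq: "g x k = (if e \<le> k then f x (\<tau> k) else 1 - f x (\<tau> k))" for x
      using k \<tau>[OF k] by (simp add: g_def twist_def)
    show "depends_only_on B J g k (input_window B J f (\<tau> k))"
      using input_window_least(1)[OF fin(2), of B f "\<tau> k"] unfolding depends_only_on_def eq by metis
  qed
  have "S \<in> complex_image (circular_permutation n c) K"
    if S: "S \<in> communication_complex (positions n) B J g" for S
  proof -
    have SI: "S \<subseteq> positions n" using S by (simp add: communication_complex_def)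
    have "S \<noteq> {} \<Longrightarrow> (\<Inter>k\<in>S. input_window B J g k) \<subseteq> (\<Inter>k\<in>\<tau> ` S. input_window B J f k)"
      using window SI by fastforce
    then have "\<tau> ` S \<in> communication_complex (positions n) B J f"
      using S \<tau>_in SI by (fastforce simp: communication_complex_def)
    moreover have "circular_permutation n c ` \<tau> ` S = S" using \<sigma>\<tau> SI by (force simp: image_image)
    ultimately show ?thesis unfolding complex_image_def using cc by (metis image_eqI subsetD)
  qed
  moreover have "g ` (J \<rightarrow>\<^sub>E B) = Mon n"
    using im twist_image[of e n] e unfolding g_def image_image[of "twist n e" f, symmetric] by simp
  ultimately show ?thesis using fin unfolding generates_def by blast
qed

lemma circular_permutation_positions:
  assumes "n \<ge> 1"
  shows "x \<in> positions n \<Longrightarrow> circular_permutation n c x \<in> positions n"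
    and "x \<in> positions n \<Longrightarrow> circular_permutation n (- c) (circular_permutation n c x) = x"
proof -
  show "x \<in> positions n \<Longrightarrow> circular_permutation n c x \<in> positions n"
    using assms by (simp add: circular_permutation_def positions_def)
  show "x \<in> positions n \<Longrightarrow> circular_permutation n (- c) (circular_permutation n c x) = x"
    by (simp add: circular_permutation_def positions_def mod_simps)
qed

lemma complex_image_inverse:
  assumes "n \<ge> 1" "K \<subseteq> Pow (positions n)"
  shows "complex_image (circular_permutation n (- c)) (complex_image (circular_permutation n c) K) = K"
proof -
  have "circular_permutation n (- c) ` circular_permutation n c ` S = S" if "S \<in> K" for S
  proof -
    have "circular_permutation n (- c) ` circular_permutation n c ` S = (\<lambda>x. x) ` S"
      unfolding image_image
      using that assms by (intro image_cong refl circular_permutation_positions(2)) auto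
    then show ?thesis by simp
  qed
  then show ?thesis by (simp add: complex_image_def image_image)
qed

lemma simplicial_complex_on_image:
  assumes "n \<ge> 1" "simplicial_complex_on (positions n) K"
  shows "simplicial_complex_on (positions n) (complex_image (circular_permutation n c) K)"
proof -
  let ?\<sigma> = "circular_permutation n c"
  have K: "K \<subseteq> Pow (positions n)" "{} \<in> K" "\<And>S T. S \<in> K \<Longrightarrow> T \<subseteq> S \<Longrightarrow> T \<in> K"
    using assms(2) unfolding simplicial_complex_on_def by blast+
  have "?\<sigma> ` S \<subseteq> positions n" if "S \<in> K" for S
    using K(1) that circular_permutation_positions(1)[OF assms(1)] by blast
  moreover have "T \<in> complex_image ?\<sigma> K" if "S \<in> K" "T \<subseteq> ?\<sigma> ` S" for S T
    using that K(3) unfolding complex_image_def by (metis image_eqI subset_imageE)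
  moreover have "{} \<in> complex_image ?\<sigma> K" using K(2) unfolding complex_image_def by force
  ultimately show ?thesis unfolding simplicial_complex_on_def complex_image_def by blast
qed

lemma singleton_complement_image:
  assumes n: "n \<ge> 1" and p: "p \<in> positions n" and "positions n - {p} \<in> K"
  shows "positions n - {circular_permutation n c p} \<in> complex_image (circular_permutation n c) K"
proof -
  let ?\<sigma> = "circular_permutation n c"
  have inj: "inj_on ?\<sigma> (positions n)"
    using circular_permutation_positions(2)[OF n] by (rule inj_on_inverseI)
  moreover have "?\<sigma> ` positions n \<subseteq> positions n" using circular_permutation_positions(1)[OF n] by blast
  ultimately have "?\<sigma> ` positions n = positions n" by (intro endo_inj_surj) (auto simp: positions_def)
  then have "?\<sigma> ` (positions n - {p}) = positions n - {?\<sigma> p}"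
    using inj_on_image_set_diff[OF inj, of "positions n" "{p}"] p by simp
  then show ?thesis using assms(3) unfolding complex_image_def by (metis image_eqI)
qed

section \<open>Intervals and the \<open>K\<^sub>5\<close> complexes\<close>

lemma cyclic_interval_image:
  "cyclic_interval n a b = (\<lambda>c. c mod int n) ` {a..a + (b - a) mod int n}"
  unfolding cyclic_interval_def by auto

lemma cyclic_interval_le:
  assumes "0 \<le> a" "a \<le> b" "b < int n"
  shows "cyclic_interval n a b = {a..b}"
proof -
  have "(b - a) mod int n = b - a" using assms by (intro mod_pos_pos_trivial) auto
  then have "cyclic_interval n a b = (\<lambda>c. c mod int n) ` {a..b}"
    by (simp add: cyclic_interval_image)
  also have "\<dots> = (\<lambda>c. c) ` {a..b}"
    using assms by (intro image_cong refl mod_pos_pos_trivial) auto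
  finally show ?thesis by simp
qed

lemma cyclic_interval_wrap:
  assumes "0 \<le> b" "b < a" "a < int n"
  shows "cyclic_interval n a b = positions n - {b<..<a}"
proof -
  have "(b - a) mod int n = (b - a + int n) mod int n" by (rule mod_add_self2[symmetric])
  also have "\<dots> = b - a + int n" using assms by (intro mod_pos_pos_trivial) auto
  finally have m: "(b - a) mod int n = b - a + int n" .
  \<comment> \<open>The representatives run from \<open>a\<close> to \<open>b + n\<close>; those
    below \<open>n\<close> are already reduced, the others reduce to \<open>{0..b}\<close>.\<close>
  have split: "{a..a + (b - a + int n)} = {a..int n - 1} \<union> (\<lambda>c. c + int n) ` {0..b}"
    using assms by (subst image_add_atLeastAtMost') auto
  have "(\<lambda>c. c mod int n) ` {a..int n - 1} = (\<lambda>c. c) ` {a..int n - 1}"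
    using assms by (intro image_cong refl mod_pos_pos_trivial) auto
  moreover have "(\<lambda>c. c mod int n) ` (\<lambda>c. c + int n) ` {0..b} = (\<lambda>c. c) ` {0..b}"
    unfolding image_image mod_add_self2
    using assms by (intro image_cong refl mod_pos_pos_trivial) auto
  ultimately have "cyclic_interval n a b = {a..int n - 1} \<union> {0..b}"
    unfolding cyclic_interval_image m split image_Un by simp
  also have "\<dots> = positions n - {b<..<a}" using assms by (auto simp: positions_def)
  finally show ?thesis .
qed

lemma is_k_interval_pred:
  assumes "n \<ge> 2"
  shows "is_k_interval n (n - 1) S \<longleftrightarrow> (\<exists>p\<in>positions n. S = positions n - {p})"
proof
  assume S: "is_k_interval n (n - 1) S"
  then have "card S = n - 1" by (simp add: is_k_interval_def)
  moreover have "S \<subseteq> positions n"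
    using S assms by (auto simp: is_k_interval_def cyclic_interval_def positions_def)
  ultimately have "card (positions n - S) = 1"
    using assms by (subst card_Diff_subset) (auto simp: positions_def intro: finite_subset)
  then obtain p where "positions n - S = {p}" by (auto simp: card_1_singleton_iff)
  then show "\<exists>p\<in>positions n. S = positions n - {p}" using \<open>S \<subseteq> positions n\<close> by blast
next
  assume "\<exists>p\<in>positions n. S = positions n - {p}"
  then obtain p where p: "p \<in> positions n" and S: "S = positions n - {p}" by blast
  have "card S = n - 1" using p S by (simp add: positions_def)
  moreover have "\<exists>a b. S = cyclic_interval n a b"
  proof -
    consider "p = 0" | "p = int n - 1" | "0 < p" "p < int n - 1"
      using p by (force simp: positions_def)
    then show ?thesis
    proof cases
      case 1
      then have "S = cyclic_interval n 1 (int n - 1)"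
        using assms S by (subst cyclic_interval_le) (auto simp: positions_def)
      then show ?thesis by blast
    next
      case 2
      then have "S = cyclic_interval n 0 (int n - 2)"
        using assms S by (subst cyclic_interval_le) (auto simp: positions_def)
      then show ?thesis by blast
    next
      case 3
      then have "S = cyclic_interval n (p + 1) (p - 1)"
        using assms S by (subst cyclic_interval_wrap) (auto simp: positions_def)
      then show ?thesis by blast
    qed
  qed
  ultimately show "is_k_interval n (n - 1) S" by (simp add: is_k_interval_def)
qed

lemma unique_pred_interval:
  assumes "n \<ge> 2"
  shows "(\<exists>!S. S \<in> K \<and> is_k_interval n (n - 1) S) \<longleftrightarrow>
    (\<exists>!p. p \<in> positions n \<and> positions n - {p} \<in> K)"
proof -
  have inj: "p = q" if "p \<in> positions n" "q \<in> positions n" "positions n - {p} = positions n - {q}" for p q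
    using that by blast
  show ?thesis unfolding is_k_interval_pred[OF assms]
    by (intro iffI; elim ex1E) (metis inj)+
qed

text \<open>The four generators are the complements of \<open>{0}\<close>,
  \<open>{j..int n - 1}\<close>, \<open>{i..j}\<close> and \<open>{1..i}\<close>. The three arcs
  cover all positions except 0, and neighbouring arcs share an endpoint.\<close>

lemma K5_complex_eq:
  assumes "1 < i" "i < j" "j < int n - 1"
  shows "K5_complex n i j = {S. S \<subseteq> positions n \<and>
    (0 \<notin> S \<or> S \<inter> {1..i} = {} \<or> S \<inter> {i..j} = {} \<or> S \<inter> {j..int n - 1} = {})}"
proof -
  have "cyclic_interval n 1 (int n - 1) = positions n - {0}"
    using assms by (subst cyclic_interval_le) (auto simp: positions_def)
  moreover have "cyclic_interval n 0 (j - 1) = positions n - {j..int n - 1}"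
    using assms by (subst cyclic_interval_le) (auto simp: positions_def)
  moreover have "cyclic_interval n (j + 1) (i - 1) = positions n - {i..j}"
    using assms by (subst cyclic_interval_wrap) (auto simp: positions_def)
  moreover have "cyclic_interval n (i + 1) 0 = positions n - {1..i}"
    using assms by (subst cyclic_interval_wrap) (auto simp: positions_def)
  ultimately show ?thesis unfolding K5_complex_def complex_generated_by_def by auto
qed

lemma generates_K5_complex:
  assumes ij: "1 < i" "i < j" "j < int n - 1"
  shows "generates (positions n) (K5_complex n i j) (Mon n)"
proof -
  define B where "B = {..<2 * n}"
  define J where "J = {..<4::nat}"
  text \<open>Source \<open>0\<close> encodes the intended break \<open>p\<close> and a bit that negates the whole word; the sources
    \<open>1, 2, 3\<close> supply bits \<open>b, c, d\<close>, and position \<open>0\<close> outputs their majority. If \<open>b, c, d\<close> are all false,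
    the word broken at \<open>p\<close> comes out; otherwise each position has seen enough of them to fall back on
    a monotone word compatible with the majority.\<close>
  define v where "v = (\<lambda>p b c d k. if k = 0 then b \<and> c \<or> b \<and> d \<or> c \<and> d
     else if p < i then k \<ge> i \<or> c \<or> d \<or> p < k
     else if j \<le> p then k > j \<and> \<not> b \<and> \<not> c \<and> p < k
     else if k \<le> i then d
     else if j \<le> k then \<not> b
     else if b = d then (p < k) \<noteq> d else d)" for p k :: int and b c d
  define f :: "(nat \<Rightarrow> nat) \<Rightarrow> int \<Rightarrow> nat" where "f = (\<lambda>x. \<lambda>k\<in>positions n.
    of_bool (v (int (x 0 div 2)) (odd (x 1) \<noteq> odd (x 0)) (odd (x 2) \<noteq> odd (x 0)) (odd (x 3) \<noteq> odd (x 0)) k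
      \<noteq> odd (x 0)))"
  \<comment> \<open>Upper bounds for the windows: source 0 is hidden from position 0, and sources 1,
    2, 3 are hidden from one arc each, so that each source corresponds to one generator of the
    complex.\<close>
  define D where "D = (\<lambda>k. (if k = 0 then {} else {0}) \<union> (if k \<in> {1..i} then {} else {1}) \<union>
    (if k \<in> {i..j} then {} else {2}) \<union> (if k \<in> {j..int n - 1} then {} else {3::nat}))"
  have dep: "depends_only_on B J f k (D k)" if k: "k \<in> positions n" for k
    unfolding depends_only_on_def
  proof (intro conjI ballI impI)
    show "D k \<subseteq> J" by (auto simp: D_def J_def)
    fix x y :: "nat \<Rightarrow> nat" assume eq: "\<forall>s\<in>D k. x s = y s"
    show "f x k = f y k"
    proof (cases "k = 0")
      \<comment> \<open>Majority commutes with negating all its arguments, so the negation bit of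
        source 0 cancels at position 0.\<close>
      case True
      then have "x 1 = y 1" "x 2 = y 2" "x 3 = y 3" using eq ij by (auto simp: D_def)
      then show ?thesis using True k by (auto simp: f_def v_def)
    next
      case False
      then have "x 0 = y 0" "k < 0 \<or> k > i \<Longrightarrow> x 1 = y 1" "k < i \<or> k > j \<Longrightarrow> x 2 = y 2"
        "k < j \<Longrightarrow> x 3 = y 3"
        using eq by (auto simp: D_def)
      then show ?thesis using False k ij 
        by (cases "k < i"; cases "k = i"; cases "k < j"; cases "k = j") (auto simp: f_def v_def positions_def)
    qed
  qed
  have "S \<in> K5_complex n i j" if S: "S \<in> communication_complex (positions n) B J f" for S
  proof (cases "S = {}")
    case False
    then obtain s where s: "\<And>k. k \<in> S \<Longrightarrow> s \<in> input_window B J f k"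
      using S by (auto simp: communication_complex_def)
    have "S \<subseteq> positions n" using S by (simp add: communication_complex_def)
    moreover have D: "s \<in> D k" if "k \<in> S" for k
      using s[OF that] input_window_least(2)[OF _ dep, of k] calculation that by (auto simp: J_def)
    moreover have "s \<in> J"
      using s S False input_window_least(1)[of J B f]
      by (force simp: depends_only_on_def J_def)
    then consider "s = 0" | "s = 1" | "s = 2" | "s = 3" unfolding J_def by fastforce
    then have "0 \<notin> S \<or> S \<inter> {1..i} = {} \<or> S \<inter> {i..j} = {} \<or> S \<inter> {j..int n - 1} = {}"
      by cases (use D in \<open>fastforce simp: D_def split: if_splits\<close>)+
    ultimately show ?thesis by (simp add: K5_complex_eq[OF ij])
  qed (simp add: K5_complex_eq[OF ij])
  moreover have "f ` (J \<rightarrow>\<^sub>E B) = Mon n"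
  proof (intro equalityI subsetI)
    fix w assume "w \<in> f ` (J \<rightarrow>\<^sub>E B)"
    then obtain x where w: "w = f x" by blast
    \<comment> \<open>The cases follow the zone of \<open>p\<close> and whether the bits override
      the intended break. The choice \<open>q = - 1\<close> stands for a constant word,
      \<open>q = 0\<close> for one in which only position 0 differs.\<close>
    have "\<exists>q s. \<forall>k. 0 \<le> k \<and> k < int n \<longrightarrow> v p b c d k = ((q < k) \<noteq> s)"
      if "0 \<le> p" for p b c d
    proof -
      consider "p < i" "c \<or> d" | "p < i" "\<not> c" "\<not> d" | "j \<le> p" "b \<or> c" | "j \<le> p" "\<not> b" "\<not> c"
        | "i \<le> p" "p < j" "b = d" | "i \<le> p" "p < j" "b = (\<not> d)"
        by (meson not_less)
      then show ?thesis
      proof cases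
        case 1
        then show ?thesis
          by (intro exI[of _ "if b \<and> c \<or> b \<and> d \<or> c \<and> d then - 1 else 0"] exI[of _ False]) (auto simp: v_def)
      next
        case 2
        then show ?thesis
          using that by (intro exI[of _ p] exI[of _ False]) (auto simp: v_def)
      next
        case 3
        then show ?thesis
          using ij by (intro exI[of _ "if b \<and> c \<or> b \<and> d \<or> c \<and> d then 0 else - 1"] exI[of _ True]) (auto simp: v_def)
      next
        case 4
        then show ?thesis
          using that ij by (intro exI[of _ p] exI[of _ False]) (auto simp: v_def)
      next
        case 5
        then show ?thesis
          using that ij by (intro exI[of _ p] exI[of _ d]) (auto simp: v_def)
      next
        case 6
        then show ?thesis
          using ij by (intro exI[of _ "if c = d then - 1 else 0"] exI[of _ "\<not> d"]) (auto simp: v_def)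
      qed
    qed
    from this[of "int (x 0 div 2)" "odd (x 1) \<noteq> odd (x 0)" "odd (x 2) \<noteq> odd (x 0)" "odd (x 3) \<noteq> odd (x 0)"]
    obtain q s where "\<forall>k. 0 \<le> k \<and> k < int n \<longrightarrow> v (int (x 0 div 2)) (odd (x 1) \<noteq> odd (x 0))
      (odd (x 2) \<noteq> odd (x 0)) (odd (x 3) \<noteq> odd (x 0)) k = ((q < k) \<noteq> s)"
      by (metis of_nat_0_le_iff)
    then have "w = step_word n (s \<noteq> odd (x 0)) q"
      unfolding w f_def step_word_def by (intro restrict_ext) (auto simp: positions_def)
    then show "w \<in> Mon n" by (simp add: step_word_Mon)
  next
    fix w assume "w \<in> Mon n"
    then obtain p s where p: "p \<in> positions n" and w: "w = step_word n s p"
      using Mon_step_word[of n w] ij by auto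
    \<comment> \<open>All sources carry the same bit \<open>s\<close>, so \<open>b\<close>,
      \<open>c\<close>, \<open>d\<close> become false after comparison with source 0, and the word
      broken at \<open>p\<close> appears.\<close>
    define x where "x = (\<lambda>t\<in>J. if t = 0 then 2 * nat p + of_bool s else of_bool s)"
    have "x \<in> J \<rightarrow>\<^sub>E B" using p by (auto simp: x_def B_def positions_def)
    moreover have x: "x 0 div 2 = nat p" "odd (x 0) = s" "odd (x 1) = s" "odd (x 2) = s" "odd (x 3) = s"
      by (auto simp: x_def J_def)
    have "w k = f x k" for k
      using p ij unfolding w f_def x by (auto simp: step_word_def v_def positions_def)
    ultimately show "w \<in> f ` (J \<rightarrow>\<^sub>E B)" by blast
  qed
  moreover have "finite B" "finite J" by (auto simp: B_def J_def)
  ultimately show ?thesis unfolding generates_def by blast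
qed

section \<open>Three disjoint hulls\<close>

text \<open>Puts generation into a form where inputs are arbitrary functions, whose sources can be
  overwritten freely, and where \<open>K\<close> enters only through the set of readers of each
  source.\<close>

lemma generates_MonE:
  assumes gen: "generates (positions n) K (Mon n)" and sc: "simplicial_complex_on (positions n) K"
  obtains J and W :: "int \<Rightarrow> nat set" and f :: "(nat \<Rightarrow> nat) \<Rightarrow> int \<Rightarrow> nat" where
    "finite J" "\<forall>p. W p \<subseteq> J" "range f = Mon n"
    "\<forall>p x y. (\<forall>s\<in>W p. x s = y s) \<longrightarrow> f x p = f y p"
    "\<forall>s. {p \<in> positions n. s \<in> W p} \<in> K"
proof -
  obtain B J :: "nat set" and f where fin: "finite B" "finite J"
    and im: "f ` (J \<rightarrow>\<^sub>E B) = Mon n" and cc: "communication_complex (positions n) B J f \<subseteq> K"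
    using gen unfolding generates_def by blast
  define W where "W = input_window B J f"
  have "step_word n False 0 \<in> f ` (J \<rightarrow>\<^sub>E B)" using im step_word_Mon by blast
  then obtain x0 where x0: "x0 \<in> J \<rightarrow>\<^sub>E B" by blast
  text \<open>Precomposing with a retraction onto \<open>J \<rightarrow>\<^sub>E B\<close> makes every function an admissible input.\<close>
  define clamp where "clamp = (\<lambda>x s. if s \<in> J \<and> x s \<in> B then x s else x0 s)"
  have clamp: "clamp x \<in> J \<rightarrow>\<^sub>E B" for x using x0 by (auto simp: clamp_def PiE_iff extensional_def)
  have clamp_id: "clamp x = x" if "x \<in> J \<rightarrow>\<^sub>E B" for x
    using that x0 by (fastforce simp: clamp_def PiE_iff extensional_def)
  have dep: "depends_only_on B J f p (W p)" for p unfolding W_def using fin(2) by (rule input_window_least(1))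
  show thesis
  proof
    show "finite J" by (fact fin(2))
    show "\<forall>p. W p \<subseteq> J" using dep by (simp add: depends_only_on_def)
    have "range clamp = J \<rightarrow>\<^sub>E B" using clamp clamp_id by (intro equalityI subsetI) (blast, metis rangeI)
    then show "range (\<lambda>x. f (clamp x)) = Mon n" using im by (metis image_image)
    show "\<forall>p x y. (\<forall>s\<in>W p. x s = y s) \<longrightarrow> f (clamp x) p = f (clamp y) p"
    proof (intro allI impI)
      fix p and x y :: "nat \<Rightarrow> nat" assume "\<forall>s\<in>W p. x s = y s"
      then have "\<forall>s\<in>W p. clamp x s = clamp y s" by (simp add: clamp_def)
      then show "f (clamp x) p = f (clamp y) p"
        using dep[of p] clamp unfolding depends_only_on_def by blast
    qed
    show "\<forall>s. {p \<in> positions n. s \<in> W p} \<in> K"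
    proof
      fix s
      have "{p \<in> positions n. s \<in> W p} \<in> communication_complex (positions n) B J f"
        unfolding communication_complex_def W_def by auto
      then show "{p \<in> positions n. s \<in> W p} \<in> K" using cc by blast
    qed
  qed
qed

text \<open>Both sides of the gap are treated together: two differing values, one on each side, are
  what lets monotonicity fix the outer positions again after each change.\<close>

lemma break_preserved:
  fixes f :: "('s \<Rightarrow> 'b) \<Rightarrow> int \<Rightarrow> nat"
  assumes fin: "finite A" and Mon: "\<And>x. f x \<in> Mon n"
    and dep: "\<And>p x y. (\<And>s. s \<in> W p \<Longrightarrow> x s = y s) \<Longrightarrow> f x p = f y p"
    and k: "0 \<le> k" "k + 1 < int n" and break: "f x k \<noteq> f x (k + 1)"
    and \<alpha>: "\<And>s. s \<in> A \<Longrightarrow> 0 \<le> \<alpha> s \<and> \<alpha> s \<le> k \<and> s \<notin> W (\<alpha> s)"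
    and \<beta>: "\<And>s. s \<in> A \<Longrightarrow> k < \<beta> s \<and> \<beta> s < int n \<and> s \<notin> W (\<beta> s)"
  shows "(\<forall>p. 0 \<le> p \<and> p \<le> k \<and> (\<forall>s\<in>A. p \<le> \<alpha> s) \<longrightarrow> f (override_on x y A) p = f x k) \<and>
    (\<forall>p. k < p \<and> p < int n \<and> (\<forall>s\<in>A. \<beta> s \<le> p) \<longrightarrow> f (override_on x y A) p = f x (k + 1))"
    (is "?L A \<and> ?R A")
  using fin \<alpha> \<beta>
proof (induction A rule: finite_psubset_induct)
  case (psubset A)
  show ?case
  proof (cases "A = {}")
    case True
    have "f x p = f x k" if "0 \<le> p" "p \<le> k" for p
      using Mon_prefix[OF Mon, of k "k + 1" x p] k break that by auto
    moreover have "f x p = f x (k + 1)" if "k < p" "p < int n" for p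
      using Mon_suffix[OF Mon, of k "k + 1" x p] k break that by auto
    ultimately show ?thesis unfolding True override_on_emptyset by blast
  next
    case False
    define z where "z = override_on x y A"
    have step: "f z p = f (override_on x y (A - {s})) p" if "s \<in> A" "s \<notin> W p" for s p
      using that by (intro dep) (auto simp: z_def override_on_def)
    text \<open>Putting the source with the leftmost \<open>\<alpha>\<close> last shows that position \<open>\<alpha> a\<close>, hence everything to its
      left, is unchanged; likewise on the right.\<close>
    obtain a where a: "a \<in> A" "\<And>s. s \<in> A \<Longrightarrow> \<alpha> a \<le> \<alpha> s"
      using arg_min_if_finite[of A \<alpha>] psubset.hyps(1) False by (meson not_less)
    obtain b where b: "b \<in> A" "\<And>s. s \<in> A \<Longrightarrow> \<beta> s \<le> \<beta> b"
      using arg_min_if_finite[of A "\<lambda>s. - \<beta> s"] psubset.hyps(1) False by (meson neg_less_iff_less not_less)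
    have "?L (A - {a})" using psubset.IH[of "A - {a}"] psubset.prems a(1) by blast
    then have za: "f z (\<alpha> a) = f x k" using step[of a "\<alpha> a"] a psubset.prems(1)[OF a(1)] by auto
    have "?R (A - {b})" using psubset.IH[of "A - {b}"] psubset.prems b(1) by blast
    then have zb: "f z (\<beta> b) = f x (k + 1)" using step[of b "\<beta> b"] b psubset.prems(2)[OF b(1)] by auto
    have ab: "0 \<le> \<alpha> a" "\<alpha> a < \<beta> b" "\<beta> b < int n" "f z (\<alpha> a) \<noteq> f z (\<beta> b)"
      using psubset.prems(1)[OF a(1)] psubset.prems(2)[OF b(1)] za zb break by auto
    have "f z p = f x k" if "0 \<le> p" "p \<le> \<alpha> a" for p
      using Mon_prefix[OF Mon ab that] za by simp
    moreover have "f z p = f x (k + 1)" if "\<beta> b \<le> p" "p < int n" for p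
      using Mon_suffix[OF Mon ab that] zb by simp
    ultimately show ?thesis using a(1) b(1) unfolding z_def by blast
  qed
qed

corollary break_preserved_0:
  fixes f :: "('s \<Rightarrow> 'b) \<Rightarrow> int \<Rightarrow> nat"
  assumes "finite A" "\<And>x. f x \<in> Mon n"
    and "\<And>p x y. (\<And>s. s \<in> W p \<Longrightarrow> x s = y s) \<Longrightarrow> f x p = f y p"
    and k: "0 \<le> k" "k + 1 < int n" and "f x k \<noteq> f x (k + 1)"
    and \<alpha>: "\<And>s. s \<in> A \<Longrightarrow> 0 \<le> \<alpha> s \<and> \<alpha> s \<le> k \<and> s \<notin> W (\<alpha> s)"
    and "\<And>s. s \<in> A \<Longrightarrow> k < \<beta> s \<and> \<beta> s < int n \<and> s \<notin> W (\<beta> s)"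
  shows "f (override_on x y A) 0 = f x k"
  using break_preserved[of A f n W k x \<alpha> \<beta> y, OF assms] k(1) \<alpha> by blast

lemma three_arcs:
  assumes gen: "generates (positions n) K (Mon n)" and sc: "simplicial_complex_on (positions n) K"
    and n: "n \<ge> 3" and avoid: "\<And>q. 1 \<le> q \<Longrightarrow> q < int n \<Longrightarrow> positions n - {q} \<notin> K"
  obtains i j where "1 < i" "i < j" "j < int n - 1"
    "positions n - {1..i} \<in> K" "positions n - {i..j} \<in> K" "positions n - {j..int n - 1} \<in> K"
proof -
  obtain J W and f :: "(nat \<Rightarrow> nat) \<Rightarrow> int \<Rightarrow> nat" where fin: "finite J" and WJ: "\<forall>p. W p \<subseteq> J"
    and rf: "range f = Mon n" and D: "\<forall>p x y. (\<forall>s\<in>W p. x s = y s) \<longrightarrow> f x p = f y p"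
    and out: "\<forall>s. {p \<in> positions n. s \<in> W p} \<in> K"
    using generates_MonE[OF gen sc] by blast
  have dep: "f x p = f y p" if "\<And>s. s \<in> W p \<Longrightarrow> x s = y s" for p x y
    using D that by blast
  have Mon: "f x \<in> Mon n" for x using rf by blast
  have down: "S \<in> K" if "T \<in> K" "S \<subseteq> T" for S T
    using sc that unfolding simplicial_complex_on_def by blast
  define P where "P = (\<lambda>s. {p \<in> positions n. s \<notin> W p})"
  have PK: "positions n - P s \<in> K" for s
    using out[rule_format, of s] by (rule back_subst[of "\<lambda>S. S \<in> K"]) (auto simp: P_def)
  have finP: "finite (P s)" for s by (rule finite_subset[of _ "positions n"]) (auto simp: P_def positions_def)
  define lo hi where "lo = (\<lambda>s. Min (P s))" and "hi = (\<lambda>s. Max (P s))"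
  \<comment> \<open>For a source read by 0 this yields two distinct positions that do not read it,
    so its hull contains a gap.\<close>
  have large: "\<not> P s \<subseteq> {q}" if "1 \<le> q" "q < int n" for s q
  proof
    assume "P s \<subseteq> {q}"
    then have "positions n - {q} \<in> K" using down[OF PK[of s]] by blast
    then show False using avoid that by blast
  qed
  have hull: "lo s \<in> P s" "hi s \<in> P s" "P s \<subseteq> {lo s..hi s}" for s
  proof -
    have "P s \<noteq> {}" using large[of 1 s] n by auto
    then show "lo s \<in> P s" "hi s \<in> P s" "P s \<subseteq> {lo s..hi s}"
      using finP[of s] by (auto simp: lo_def hi_def)
  qed
  have lohi: "1 \<le> lo s" "lo s < hi s" "hi s < int n" if s: "s \<in> W 0" for s
  proof -
    have "0 \<notin> P s" using s by (simp add: P_def)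
    then have "lo s \<noteq> 0" using hull(1)[of s] by metis
    then show lo: "1 \<le> lo s" using hull(1)[of s] by (auto simp: P_def positions_def)
    show hi: "hi s < int n" using hull(2)[of s] by (auto simp: P_def positions_def)
    have "lo s \<le> hi s" using hull(1)[of s] hull(3)[of s] by auto
    moreover have "lo s \<noteq> hi s" using large[OF lo, of s] hi hull(3)[of s] calculation by auto
    ultimately show "lo s < hi s" by simp
  qed
  have unpierced: "\<exists>s\<in>W 0. \<not> (lo s \<le> k \<and> k < hi s) \<and> \<not> (lo s \<le> l \<and> l < hi s)"
    if k: "1 \<le> k" "k \<le> int n - 2" and l: "1 \<le> l" "l \<le> int n - 2" for k l
  proof (rule ccontr)
    assume "\<not> ?thesis"
    then have pierced: "lo s \<le> k \<and> k < hi s \<or> lo s \<le> l \<and> l < hi s" if "s \<in> W 0" for s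
      using that by blast
    have notW: "s \<notin> W (lo s)" "s \<notin> W (hi s)" for s using hull[of s] by (auto simp: P_def)
    obtain u v where u: "f u = step_word n False k" and v: "f v = step_word n True l"
      using rf step_word_Mon by (metis imageE)
    \<comment> \<open>The mixed input takes \<open>v\<close> on \<open>A\<close> and
      \<open>u\<close> on the rest of \<open>W 0\<close>. As a change of \<open>u\<close> on
      \<open>A\<close> it keeps the output 0 at position 0; as a change of \<open>v\<close> on
      \<open>W 0 - A\<close> it keeps the output 1.\<close>
    define A where "A = {s \<in> W 0. lo s \<le> k \<and> k < hi s}"
    have finA: "finite A" "finite (W 0 - A)"
      using finite_subset[OF WJ[rule_format, of 0] fin] by (auto simp: A_def)
    have A: "lo s \<le> k" "k < hi s" "s \<in> W 0" if "s \<in> A" for s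
      using that by (auto simp: A_def)
    have "f (override_on u v A) 0 = f u k"
    proof (rule break_preserved_0[of A f n W k u lo hi v, OF finA(1) Mon dep])
      show "f u k \<noteq> f u (k + 1)" "0 \<le> k" "k + 1 < int n"
        using k by (auto simp: u step_word_def positions_def)
      show "0 \<le> lo s \<and> lo s \<le> k \<and> s \<notin> W (lo s)" "k < hi s \<and> hi s < int n \<and> s \<notin> W (hi s)"
        if "s \<in> A" for s
        using A[OF that] lohi[of s] notW[of s] by auto
    qed
    moreover have B: "lo s \<le> l" "l < hi s" "s \<in> W 0" if "s \<in> W 0 - A" for s
      using that pierced[of s] by (auto simp: A_def)
    have "f (override_on v u (W 0 - A)) 0 = f v l"
    proof (rule break_preserved_0[of "W 0 - A" f n W l v lo hi u, OF finA(2) Mon dep])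
      show "f v l \<noteq> f v (l + 1)" "0 \<le> l" "l + 1 < int n"
        using l by (auto simp: v step_word_def positions_def)
      show "0 \<le> lo s \<and> lo s \<le> l \<and> s \<notin> W (lo s)" "l < hi s \<and> hi s < int n \<and> s \<notin> W (hi s)"
        if "s \<in> W 0 - A" for s
        using B[OF that] lohi[of s] notW[of s] by auto
    qed
    moreover have "f (override_on u v A) 0 = f (override_on v u (W 0 - A)) 0"
      by (rule dep) (auto simp: override_on_def)
    ultimately show False using k l by (simp add: u v step_word_def positions_def)
  qed
  \<comment> \<open>Greedy choice for disjoint intervals: among the hulls starting at
    \<open>a\<close> or later, one that ends first.\<close>
  define first where "first = (\<lambda>a. ARG_MIN hi s. s \<in> W 0 \<and> a \<le> lo s)"
  have first: "first a \<in> W 0" "a \<le> lo (first a)" "\<And>s. s \<in> W 0 \<Longrightarrow> a \<le> lo s \<Longrightarrow> hi (first a) \<le> hi s"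
    if "\<exists>s\<in>W 0. a \<le> lo s" for a
  proof -
    let ?S = "{s \<in> W 0. a \<le> lo s}"
    have "finite ?S" using finite_subset[OF WJ[rule_format, of 0] fin] by auto
    moreover have "?S \<noteq> {}" using that by blast
    ultimately have "is_arg_min hi (\<lambda>s. s \<in> ?S) (arg_min_on hi ?S)"
      using arg_min_if_finite by (metis (mono_tags, lifting) is_arg_min_linorder linorder_not_less)
    then show "first a \<in> W 0" "a \<le> lo (first a)" "\<And>s. s \<in> W 0 \<Longrightarrow> a \<le> lo s \<Longrightarrow> hi (first a) \<le> hi s"
      by (auto simp: is_arg_min_linorder arg_min_on_def first_def)
  qed
  define s1 where "s1 = first 1"
  have "\<exists>s\<in>W 0. 1 \<le> lo s" using unpierced[of 1 1] lohi n by fastforce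
  note s1 = first[OF this, folded s1_def]
  \<comment> \<open>The last gap inside the hull of \<open>s1\<close> is \<open>hi s1 - 1\<close>. A
    hull that avoids it and ends no earlier starts at \<open>hi s1\<close> or later. Disjointness
    concerns gaps, so hulls may share an end position.\<close>
  have "\<exists>s\<in>W 0. hi s1 \<le> lo s"
    using unpierced[of "hi s1 - 1" "hi s1 - 1"] lohi[of s1] s1 lohi(1) by fastforce
  define s2 where "s2 = first (hi s1)"
  note s2 = first[OF \<open>\<exists>s\<in>W 0. hi s1 \<le> lo s\<close>, folded s2_def]
  obtain s3 where s3: "s3 \<in> W 0" "\<not> (lo s3 \<le> hi s1 - 1 \<and> hi s1 - 1 < hi s3)"
    "\<not> (lo s3 \<le> hi s2 - 1 \<and> hi s2 - 1 < hi s3)"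
    using unpierced[of "hi s1 - 1" "hi s2 - 1"] lohi[of s1] lohi[of s2] s1(1) s2(1) by fastforce
  then have "hi s1 \<le> lo s3" using s1(3)[of s3] lohi[of s3] by auto
  then have "hi s2 \<le> lo s3" using s2(3)[of s3] s3 by auto
  show thesis
  proof (rule that)
    show "1 < hi s1" "hi s1 < hi s2" "hi s2 < int n - 1"
      using lohi[of s1] lohi[of s2] lohi[of s3] s1(1) s2(1,2) s3(1) \<open>hi s2 \<le> lo s3\<close> by auto
    \<comment> \<open>The hulls are enlarged to arcs covering all of \<open>{1..int n - 1}\<close>;
      their complements only shrink and so remain simplices.\<close>
    show "positions n - {1..hi s1} \<in> K"
      by (rule down[OF PK[of s1]]) (use hull(3)[of s1] lohi[of s1] s1(1) in auto)
    show "positions n - {hi s1..hi s2} \<in> K"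
      by (rule down[OF PK[of s2]]) (use hull(3)[of s2] lohi[of s2] s2(1,2) in auto)
    show "positions n - {hi s2..int n - 1} \<in> K"
      by (rule down[OF PK[of s3]]) (use hull(3)[of s3] lohi[of s3] s3(1) \<open>hi s2 \<le> lo s3\<close> in auto)
  qed
qed

section \<open>The large simplex is needed\<close>

text \<open>\<open>b\<close>, \<open>c\<close>, \<open>d\<close> stand for the groups of sources that miss \<open>[1, i]\<close>, \<open>[i, j]\<close> and \<open>[j, n - 1]\<close>, and \<open>y\<close>
  for the sources not read by \<open>0\<close>. The last assumption says that any two choices of \<open>y\<close> are linked by
  steps each of which leaves the strategy of some position \<open>q > 0\<close> unchanged.\<close>

lemma no_common_strategy:
  fixes h :: "'x \<Rightarrow> 'x \<Rightarrow> 'x \<Rightarrow> 'x \<Rightarrow> int \<Rightarrow> nat"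
  assumes ij: "1 < i" "i < j" "j < int n - 1"
    and Mon: "\<And>y b c d. h y b c d \<in> Mon n"
    and h0: "\<And>y y' b c d. h y b c d 0 = h y' b c d 0"
    and hb: "\<And>y b b' c d p. 1 \<le> p \<Longrightarrow> p \<le> i \<Longrightarrow> h y b c d p = h y b' c d p"
    and hc: "\<And>y b c c' d p. i \<le> p \<Longrightarrow> p \<le> j \<Longrightarrow> h y b c d p = h y b c' d p"
    and hd: "\<And>y b c d d' p. j \<le> p \<Longrightarrow> p < int n \<Longrightarrow> h y b c d p = h y b c d' p"
    and surj: "\<And>w. w \<in> Mon n \<Longrightarrow> \<exists>z. h z z z z = w"
    and conn: "\<And>Q y y'. (\<And>y y' q. 1 \<le> q \<Longrightarrow> q < int n \<Longrightarrow> (\<And>b c d. h y b c d q = h y' b c d q) \<Longrightarrow>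
      Q y \<Longrightarrow> Q y') \<Longrightarrow> Q y \<Longrightarrow> Q y'"
  shows False
proof -
  have h01: "h y b c d p = 0 \<or> h y b c d p = 1" if "0 \<le> p" "p < int n" for y b c d p
    using Mon_01[OF Mon] that by blast
  note prefix = Mon_prefix[OF Mon] and suffix = Mon_suffix[OF Mon] and between = Mon_between[OF Mon]
  have word: "\<exists>z. h z z z z p = v \<and> h z z z z q = 1 - v"
    if "0 \<le> p" "p < q" "q < int n" "v \<in> {0, 1}" for p q v
  proof -
    obtain z where "h z z z z = step_word n (v = 1) p" using surj step_word_Mon by blast
    then show ?thesis using that by (intro exI[of _ z]) (auto simp: step_word_def positions_def)
  qed
  \<comment> \<open>Positions 1 and \<open>i\<close> both ignore \<open>b\<close>, so a break
    between them survives every change of \<open>b\<close> and position 0 keeps its value;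
    \<open>h0\<close> removes \<open>y\<close>. The next two facts do the same with the other
    arcs.\<close>
  have cert_cd: "\<exists>c d. \<forall>y b. h y b c d 0 = v" if v: "v \<in> {0, 1}" for v
  proof -
    obtain z where z: "h z z z z 1 = v" "h z z z z i = 1 - v" using word[of 1 i v] ij v by auto
    have "h z b z z 0 = v" for b
      using prefix[of 1 i z b z z 0] hb[of 1 z b z z z] hb[of i z b z z z] z ij v by auto
    then show ?thesis using h0 by metis
  qed
  have cert_bd: "\<exists>b d. \<forall>y c. h y b c d 0 = v" if v: "v \<in> {0, 1}" for v
  proof -
    obtain z where z: "h z z z z i = v" "h z z z z j = 1 - v" using word[of i j v] ij v by auto
    have "h z z c z 0 = v" for c
      using prefix[of i j z z c z 0] hc[of i z z c z z] hc[of j z z c z z] z ij v by auto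
    then show ?thesis using h0 by metis
  qed
  have cert_bc: "\<exists>b c. \<forall>y d. h y b c d 0 = v" if v: "v \<in> {0, 1}" for v
  proof -
    let ?m = "int n - 1"
    obtain z where z: "h z z z z j = v" "h z z z z ?m = 1 - v" using word[of j ?m v] ij v by auto
    have "h z z z d 0 = v" for d
      using prefix[of j ?m z z z d 0] hd[of j z z z d z] hd[of ?m z z z d z] z ij v by auto
    then show ?thesis using h0 by metis
  qed
  define Q where "Q = (\<lambda>v y. \<forall>b c d. h y b c d i = v)"
  \<comment> \<open>Position \<open>i\<close> depends only on \<open>d\<close> and \<open>y\<close>,
    position \<open>j\<close> only on \<open>b\<close> and \<open>y\<close>. Forcing 0 to
    \<open>1 - v\<close> moves the break before \<open>i\<close>, which carries \<open>v\<close>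
    over to \<open>j\<close>; forcing 0 to \<open>v\<close> carries it back from \<open>j\<close> to
    \<open>i\<close>.\<close>
  have Q_j: "Q v y \<longleftrightarrow> (\<forall>b c d. h y b c d j = v)" if v: "v \<in> {0, 1}" for v y
  proof
    assume Q: "Q v y"
    obtain c0 d0 where F: "\<And>b. h y b c0 d0 0 = 1 - v" using cert_cd[of "1 - v"] v by fastforce
    have "h y b c0 d0 j = v" for b
      using suffix[of 0 i y b c0 d0 j] F[of b] Q ij v by (auto simp: Q_def)
    then have "h y b c d j = v" for b c d
      using hc[of j y b c d c0] hd[of j y b c0 d d0] ij by auto
    then show "\<forall>b c d. h y b c d j = v" by blast
  next
    assume j: "\<forall>b c d. h y b c d j = v"
    obtain b0 c0 where F: "\<And>d. h y b0 c0 d 0 = v" using cert_bc[OF v] by blast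
    have "h y b0 c0 d i = v" for d
      using between[of 0 i j y b0 c0 d] F[of d] j ij by auto
    then have "h y b c d i = v" for b c d
      using hb[of i y b c d b0] hc[of i y b0 c d c0] ij by auto
    then show "Q v y" by (simp add: Q_def)
  qed
  \<comment> \<open>Together with \<open>neg\<close> this reads \<open>Q v y\<close> off the
    strategy of any \<open>q > 0\<close>: if it holds, some \<open>c\<close> forces \<open>v\<close>
    against all \<open>b\<close>, \<open>d\<close>; if it fails, some \<open>b\<close>,
    \<open>d\<close> force \<open>1 - v\<close> against all \<open>c\<close>. The two exclude each
    other.\<close>
  have pos: "\<exists>c. \<forall>b d. h y b c d q = v"
    if v: "v \<in> {0, 1}" and Q: "Q v y" and q: "1 \<le> q" "q < int n" for v y q
  proof -
    have i: "h y b c d i = v" for b c d using Q by (simp add: Q_def)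
    have j: "h y b c d j = v" for b c d using Q Q_j[OF v, of y] by blast
    consider "q \<le> i" | "i \<le> q" "q \<le> j" | "j \<le> q" by linarith
    then show ?thesis
    proof cases
      case 1
      obtain b0 c0 where F: "\<And>d. h y b0 c0 d 0 = v" using cert_bc[OF v] by blast
      have "h y b c0 d q = v" for b d
        using between[of 0 q i y b0 c0 d] F[of d] i hb[of q y b c0 d b0] 1 q ij by auto
      then show ?thesis by blast
    next
      case 2
      then have "h y b c d q = v" for b c d
        using between[of i q j y b c d] i j q ij by auto
      then show ?thesis by blast
    next
      case 3
      obtain c0 d0 where F: "\<And>b. h y b c0 d0 0 = 1 - v" using cert_cd[of "1 - v"] v by fastforce
      have "h y b c0 d q = v" for b d
        using suffix[of 0 i y b c0 d0 q] F[of b] i[of b c0 d0] hd[of q y b c0 d d0] 3 q ij v by auto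
      then show ?thesis by blast
    qed
  qed
  have neg: "\<exists>b d. \<forall>c. h y b c d q = 1 - v"
    if v: "v \<in> {0, 1}" and nQ: "\<not> Q v y" and q: "1 \<le> q" "q < int n" for v y q
  proof (cases "Q (1 - v) y")
    case True
    have v': "1 - v \<in> {0, 1}" using v by auto
    have i: "h y b c d i = 1 - v" for b c d using True by (simp add: Q_def)
    have j: "h y b c d j = 1 - v" for b c d using True Q_j[OF v', of y] by blast
    consider "q \<le> i" | "i \<le> q" "q \<le> j" | "j \<le> q" by linarith
    then show ?thesis
    proof cases
      case 1
      obtain b0 d0 where F: "\<And>c. h y b0 c d0 0 = 1 - v" using cert_bd[OF v'] by blast
      have "h y b0 c d0 q = 1 - v" for c
        using between[of 0 q i y b0 c d0] F[of c] i 1 q ij by auto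
      then show ?thesis by blast
    next
      case 2
      then have "h y b c d q = 1 - v" for b c d
        using between[of i q j y b c d] i j q ij by auto
      then show ?thesis by blast
    next
      case 3
      obtain b0 d0 where F: "\<And>c. h y b0 c d0 0 = v" using cert_bd[OF v] by blast
      have "h y b0 c d0 q = 1 - v" for c
        using suffix[of 0 i y b0 c d0 q] F[of c] i[of b0 c d0] 3 q ij v by auto
      then show ?thesis by blast
    qed
  next
    case False
    \<comment> \<open>Neither position is constant for this \<open>y\<close>, so \<open>d\<close>
      alone can set \<open>i\<close> to either value and \<open>b\<close> alone can set
      \<open>j\<close> to either value.\<close>
    have i: "\<exists>d. \<forall>b c. h y b c d i = u" and j: "\<exists>b. \<forall>c d. h y b c d j = u" if u: "u \<in> {0, 1}" for u
    proof -
      have "\<not> Q (1 - u) y" using nQ False u v by auto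
      then obtain b0 c0 d0 b1 c1 d1 where "h y b0 c0 d0 i \<noteq> 1 - u" "h y b1 c1 d1 j \<noteq> 1 - u"
        using Q_j[of "1 - u" y] u unfolding Q_def by fastforce
      then have u': "h y b0 c0 d0 i = u" "h y b1 c1 d1 j = u"
        using h01[of i y b0 c0 d0] h01[of j y b1 c1 d1] ij u by auto
      have "h y b c d0 i = u" for b c
        using u'(1) hb[of i y b c d0 b0] hc[of i y b0 c d0 c0] ij by auto
      then show "\<exists>d. \<forall>b c. h y b c d i = u" by blast
      have "h y b1 c d j = u" for c d
        using u'(2) hd[of j y b1 c d d1] hc[of j y b1 c d1 c1] ij by auto
      then show "\<exists>b. \<forall>c d. h y b c d j = u" by blast
    qed
    have v': "1 - v \<in> {0, 1}" using v by auto
    consider "q \<le> i" | "i \<le> q" "q \<le> j" | "j \<le> q" by linarith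
    then show ?thesis
    proof cases
      case 1
      obtain b0 d0 where bd: "\<And>b c. h y b c d0 i = 1 - v" "\<And>c d. h y b0 c d j = v"
        using i[OF v'] j[OF v] by blast
      have "h y b0 c d0 q = 1 - v" for c
        using prefix[of i j y b0 c d0 q] bd(1)[of b0 c] bd(2)[of c d0] 1 q ij v by auto
      then show ?thesis by blast
    next
      case 2
      obtain b0 d0 where bd: "\<And>b c. h y b c d0 i = 1 - v" "\<And>c d. h y b0 c d j = 1 - v"
        using i[OF v'] j[OF v'] by blast
      have "h y b0 c d0 q = 1 - v" for c
        using between[of i q j y b0 c d0] bd(1)[of b0 c] bd(2)[of c d0] 2 q ij by auto
      then show ?thesis by blast
    next
      case 3
      obtain b0 d0 where bd: "\<And>b c. h y b c d0 i = v" "\<And>c d. h y b0 c d j = 1 - v"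
        using i[OF v] j[OF v'] by blast
      have "h y b0 c d0 q = 1 - v" for c
        using suffix[of i j y b0 c d0 q] bd(1)[of b0 c] bd(2)[of c d0] 3 q ij v by auto
      then show ?thesis by blast
    qed
  qed
  have Q_const: "Q v y'" if v: "v \<in> {0, 1}" and Q: "Q v y" for v y y'
  proof (rule conn[of "Q v", OF _ Q])
    fix y y' q assume q: "1 \<le> q" "q < int n" and eq: "\<And>b c d. h y b c d q = h y' b c d q" and Q: "Q v y"
    show "Q v y'"
    proof (rule ccontr)
      assume "\<not> Q v y'"
      then obtain b d where n: "\<And>c. h y' b c d q = 1 - v" using neg[OF v _ q] by blast
      obtain c where "h y b c d q = v" using pos[OF v Q q] by blast
      then show False using n[of c] eq[of b c d] v by auto
    qed
  qed
  have "\<not> Q v y" if v: "v \<in> {0, 1}" for v y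
  proof
    assume "Q v y"
    obtain z where "h z z z z = step_word n (v = 1) 0" using surj step_word_Mon by blast
    then have "h z z z z i \<noteq> v" using v ij by (auto simp: step_word_def positions_def)
    then show False using Q_const[OF v \<open>Q v y\<close>, of z] by (simp add: Q_def)
  qed
  moreover have "\<exists>v\<in>{0, 1}. \<exists>y. Q v y"
  proof (rule ccontr)
    assume nQ: "\<not> ?thesis"
    \<comment> \<open>Positions 1 and \<open>i\<close> show 0 and 1 whatever \<open>b\<close> is,
      while a suitable \<open>b\<close> turns position \<open>j\<close> to 0: the pattern
      010.\<close>
    obtain z where z: "h z z z z 1 = 0" "h z z z z i = 1" using word[of 1 i 0] ij by auto
    obtain b c d where "h z b c d j \<noteq> 1" using nQ Q_j[of 1 z] by auto
    then have "h z b z z j = 0"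
      using h01[of j z b c d] hc[of j z b c d z] hd[of j z b z d z] ij by auto
    moreover have "h z b z z 1 = 0" "h z b z z i = 1"
      using z hb[of 1 z b z z z] hb[of i z b z z z] ij by auto
    ultimately show False using between[of 1 i j z b z z] ij by auto
  qed
  ultimately show False by blast
qed

text \<open>If the simplex were absent, every source would be missed by some \<open>q > 0\<close>.
  Grouping the sources read by 0 according to an arc that misses them puts \<open>f\<close> in the
  form excluded by \<open>no_common_strategy\<close>.\<close>

lemma contains_large_interval:
  assumes ij: "1 < i" "i < j" "j < int n - 1"
    and gen: "generates (positions n) K (Mon n)" and sc: "simplicial_complex_on (positions n) K"
    and sub: "K \<subseteq> K5_complex n i j"
  shows "positions n - {0} \<in> K"
proof (rule ccontr)
  assume no: "positions n - {0} \<notin> K"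
  obtain J W and f :: "(nat \<Rightarrow> nat) \<Rightarrow> int \<Rightarrow> nat" where fin: "finite J" and WJ: "\<forall>p. W p \<subseteq> J"
    and rf: "range f = Mon n" and D: "\<forall>p x y. (\<forall>s\<in>W p. x s = y s) \<longrightarrow> f x p = f y p"
    and out: "\<forall>s. {p \<in> positions n. s \<in> W p} \<in> K"
    using generates_MonE[OF gen sc] by blast
  have dep: "f x p = f y p" if "\<And>s. s \<in> W p \<Longrightarrow> x s = y s" for p x y
    using D that by blast
  define Ob where "Ob = (\<lambda>s. \<forall>p\<in>{1..i}. s \<notin> W p)"
  define Oc where "Oc = (\<lambda>s. \<forall>p\<in>{i..j}. s \<notin> W p)"
  define Od where "Od = (\<lambda>s. \<forall>p\<in>{j..int n - 1}. s \<notin> W p)"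
  have cover: "Ob s \<or> Oc s \<or> Od s" if "s \<in> W 0" for s
  proof -
    have "{p \<in> positions n. s \<in> W p} \<in> K5_complex n i j" using out sub by blast
    moreover have "{1..i} \<subseteq> positions n" "{i..j} \<subseteq> positions n" "{j..int n - 1} \<subseteq> positions n" "0 \<in> positions n"
      using ij by (auto simp: positions_def)
    ultimately show ?thesis using that unfolding K5_complex_eq[OF ij] Ob_def Oc_def Od_def by blast
  qed
  have missed: "\<exists>q. 1 \<le> q \<and> q < int n \<and> s \<notin> W q" for s
  proof (rule ccontr)
    assume "\<not> ?thesis"
    then have "positions n - {0} \<subseteq> {p \<in> positions n. s \<in> W p}" by (force simp: positions_def)
    then show False using no out sc unfolding simplicial_complex_on_def by blast
  qed
  define mix where "mix = (\<lambda>y b c d s. if s \<in> W 0 then if Ob s then b s else if Oc s then c s else d s else y s :: nat)"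
    for y b c d
  define h where "h = (\<lambda>y b c d. f (mix y b c d))"
  show False
  proof (rule no_common_strategy[OF ij, of h])
    show "h y b c d \<in> Mon n" for y b c d using rf by (auto simp: h_def)
    show "h y b c d 0 = h y' b c d 0" for y y' b c d
      unfolding h_def by (rule dep) (simp add: mix_def)
    show "h y b c d p = h y b' c d p" if "1 \<le> p" "p \<le> i" for y b b' c d p
      unfolding h_def by (rule dep) (use that in \<open>auto simp: mix_def Ob_def\<close>)
    show "h y b c d p = h y b c' d p" if "i \<le> p" "p \<le> j" for y b c c' d p
      unfolding h_def by (rule dep) (use that in \<open>auto simp: mix_def Oc_def\<close>)
    show "h y b c d p = h y b c d' p" if "j \<le> p" "p < int n" for y b c d d' p
    proof -
      have nOd: "\<not> Od s" if "s \<in> W p" for s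
        using that \<open>j \<le> p\<close> \<open>p < int n\<close> by (auto simp: Od_def intro!: bexI[of _ p])
      show ?thesis unfolding h_def by (rule dep) (use cover nOd in \<open>auto simp: mix_def\<close>)
    qed
    show "\<exists>z. h z z z z = w" if "w \<in> Mon n" for w
    proof -
      have "w \<in> range f" using rf that by simp
      then obtain z where "w = f z" by (rule rangeE)
      moreover have "mix z z z z = z" by (rule ext) (simp add: mix_def)
      ultimately have "h z z z z = w" by (simp add: h_def)
      then show ?thesis by blast
    qed
  next
    fix Q and y y' :: "nat \<Rightarrow> nat"
    assume inv: "\<And>y y' q. 1 \<le> q \<Longrightarrow> q < int n \<Longrightarrow> (\<And>b c d. h y b c d q = h y' b c d q) \<Longrightarrow> Q y \<Longrightarrow> Q y'"
      and Q: "Q y"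
    \<comment> \<open>Sources are switched from \<open>y\<close> to \<open>y'\<close> one at a time;
      a position missing the switched source keeps its strategy. Sources outside \<open>J\<close>
      are read by nobody and are switched all at once at the end.\<close>
    have "Q (override_on y y' A)" if "finite A" for A
      using that
    proof induction
      case (insert s A)
      obtain q where q: "1 \<le> q" "q < int n" "s \<notin> W q" using missed by blast
      have "h (override_on y y' A) b c d q = h (override_on y y' (insert s A)) b c d q" for b c d
        unfolding h_def by (rule dep) (use q(3) in \<open>auto simp: mix_def override_on_def\<close>)
      then show ?case by (rule inv[OF q(1,2) _ insert.IH])
    qed (use Q in simp)
    from this[OF fin] have QJ: "Q (override_on y y' J)" .
    have h1: "h (override_on y y' J) b c d 1 = h y' b c d 1" for b c d
      unfolding h_def by (rule dep) (use WJ in \<open>auto simp: mix_def override_on_def\<close>)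
    show "Q y'"
      by (rule inv[of 1, OF _ _ h1 QJ]) (use ij in auto)
  qed
qed

section \<open>Minimal complexes\<close>

lemma simplicial_complex_on_K5_complex:
  assumes ij: "1 < i" "i < j" "j < int n - 1"
  shows "simplicial_complex_on (positions n) (K5_complex n i j)"
  unfolding K5_complex_eq[OF ij] simplicial_complex_on_def by blast

lemma K5_complex_subset:
  assumes ij: "1 < i" "i < j" "j < int n - 1" and sc: "simplicial_complex_on (positions n) K"
    and "positions n - {0} \<in> K" "positions n - {1..i} \<in> K" "positions n - {i..j} \<in> K"
      "positions n - {j..int n - 1} \<in> K"
  shows "K5_complex n i j \<subseteq> K"
proof
  have down: "S \<in> K" if "T \<in> K" "S \<subseteq> T" for S T
    using sc that unfolding simplicial_complex_on_def by blast
  fix S assume "S \<in> K5_complex n i j"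
  then have "S \<subseteq> positions n - {0} \<or> S \<subseteq> positions n - {1..i} \<or> S \<subseteq> positions n - {i..j} \<or>
      S \<subseteq> positions n - {j..int n - 1}"
    unfolding K5_complex_eq[OF ij] by blast
  then show "S \<in> K" using down assms(5-) by blast
qed

text \<open>Each of the three arcs has at least two points, so removing a single position cannot
  empty it.\<close>

lemma singleton_complement_K5_complex:
  assumes ij: "1 < i" "i < j" "j < int n - 1" and p: "p \<in> positions n"
  shows "positions n - {p} \<in> K5_complex n i j \<longleftrightarrow> p = 0"
proof -
  have two: "(positions n - {p}) \<inter> {a..b} \<noteq> {}" if "0 \<le> a" "a < b" "b < int n" for a b
  proof -
    have "a \<in> positions n" "b \<in> positions n" using that by (auto simp: positions_def)
    then show ?thesis using that by (cases "p = a") auto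
  qed
  have "0 \<in> positions n" using ij by (simp add: positions_def)
  then show ?thesis
    using two[of 1 i] two[of i j] two[of j "int n - 1"] ij unfolding K5_complex_eq[OF ij] by auto
qed

lemma generating_subcomplex_of_K5_complex:
  assumes ij: "1 < i" "i < j" "j < int n - 1"
    and gen: "generates (positions n) K (Mon n)" and sc: "simplicial_complex_on (positions n) K"
    and sub: "K \<subseteq> K5_complex n i j"
  shows "K = K5_complex n i j"
proof -
  have n: "n \<ge> 3" using ij by linarith
  have "positions n - {q} \<notin> K" if "1 \<le> q" "q < int n" for q
    using singleton_complement_K5_complex[OF ij, of q] sub that by (auto simp: positions_def)
  then obtain k l where kl: "1 < k" "k < l" "l < int n - 1" and arcs: "positions n - {1..k} \<in> K"
    "positions n - {k..l} \<in> K" "positions n - {l..int n - 1} \<in> K"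
    using three_arcs[OF gen sc n] by blast
  have arc: "{1..i} \<subseteq> {a..b} \<or> {i..j} \<subseteq> {a..b} \<or> {j..int n - 1} \<subseteq> {a..b}"
    if "positions n - {a..b} \<in> K" "1 \<le> a" for a b
  proof -
    have "positions n - {a..b} \<in> K5_complex n i j" using that sub by blast
    moreover have "0 \<in> positions n - {a..b}" using that ij by (simp add: positions_def)
    moreover have "{1..i} \<subseteq> positions n" "{i..j} \<subseteq> positions n" "{j..int n - 1} \<subseteq> positions n"
      using ij by (auto simp: positions_def)
    ultimately show ?thesis unfolding K5_complex_eq[OF ij] by blast
  qed
  \<comment> \<open>The arc \<open>{k..l}\<close> contains neither 1 nor \<open>n - 1\<close>, so
    the only arc of the given complex it can contain is \<open>{i..j}\<close>. The outer two arcs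
    then give the reverse inequalities.\<close>
  have "k \<le> i \<and> j \<le> l" using arc[OF arcs(2)] kl ij by auto
  then have "k = i" "l = j" using arc[OF arcs(1)] arc[OF arcs(3)] kl ij by auto
  moreover have "positions n - {0} \<in> K" by (rule contains_large_interval[OF ij gen sc sub])
  ultimately have "K5_complex n i j \<subseteq> K" using K5_complex_subset[OF ij sc] arcs by blast
  then show ?thesis using sub by blast
qed

text \<open>Rotating the missing position \<open>p\<close> to 0 makes \<open>three_arcs\<close>
  applicable; it yields a generating complex of the family inside \<open>K\<close>, which equals
  \<open>K\<close> by minimality.\<close>

lemma minimal_in_K5_family:
  assumes n: "n \<ge> 3" and K: "minimal_generating (positions n) K (Mon n)"
    and ex1: "\<exists>!p. p \<in> positions n \<and> positions n - {p} \<in> K"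
  shows "in_K5_family n K"
proof -
  have sc: "simplicial_complex_on (positions n) K" and gen: "generates (positions n) K (Mon n)"
    using K by (auto simp: minimal_generating_def)
  have n1: "n \<ge> 1" using n by simp
  obtain p where p: "p \<in> positions n" "positions n - {p} \<in> K"
    and uniq: "\<And>q. q \<in> positions n \<Longrightarrow> positions n - {q} \<in> K \<Longrightarrow> q = p" using ex1 by blast
  define L where "L = complex_image (circular_permutation n (- p)) K"
  have scL: "simplicial_complex_on (positions n) L"
    unfolding L_def by (rule simplicial_complex_on_image[OF n1 sc])
  have genL: "generates (positions n) L (Mon n)"
    unfolding L_def by (rule generates_circular_permutation[OF gen n1])
  have KL: "complex_image (circular_permutation n p) L = K"
    using complex_image_inverse[OF n1, of K "- p"] sc by (simp add: L_def simplicial_complex_on_def)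
  have zero: "positions n - {0} \<in> L"
    using singleton_complement_image[OF n1 p, of "- p"] by (simp add: L_def circular_permutation_def)
  have "positions n - {q} \<notin> L" if q: "1 \<le> q" "q < int n" for q
  proof
    assume qL: "positions n - {q} \<in> L"
    have qp: "q \<in> positions n" using q by (simp add: positions_def)
    have "circular_permutation n p q = p"
      using singleton_complement_image[OF n1 qp qL, of p] circular_permutation_positions(1)[OF n1 qp, of p]
      by (intro uniq) (simp_all add: KL)
    then have "q = circular_permutation n (- p) p"
      using circular_permutation_positions(2)[OF n1 qp, of p] by simp
    then show False using q by (simp add: circular_permutation_def)
  qed
  then obtain i j where ij: "1 < i" "i < j" "j < int n - 1" and arcs: "positions n - {1..i} \<in> L"
    "positions n - {i..j} \<in> L" "positions n - {j..int n - 1} \<in> L"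
    using three_arcs[OF genL scL n] by blast
  let ?K5 = "complex_image (circular_permutation n p) (K5_complex n i j)"
  have "?K5 \<subseteq> K"
    unfolding KL[symmetric] using K5_complex_subset[OF ij scL zero arcs] by (auto simp: complex_image_def)
  moreover have "generates (positions n) ?K5 (Mon n)"
    by (rule generates_circular_permutation[OF generates_K5_complex[OF ij] n1])
  moreover have "simplicial_complex_on (positions n) ?K5"
    by (rule simplicial_complex_on_image[OF n1 simplicial_complex_on_K5_complex[OF ij]])
  ultimately have "K = ?K5" using K unfolding minimal_generating_def by blast
  moreover have "n \<ge> 5" using ij by linarith
  ultimately show ?thesis using ij unfolding in_K5_family_def by blast
qed

lemma K5_family_minimal:
  assumes "in_K5_family n K"
  shows "minimal_generating (positions n) K (Mon n)"
    and "\<exists>!p. p \<in> positions n \<and> positions n - {p} \<in> K"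
proof -
  obtain c i j where n: "n \<ge> 5" and ij: "1 < i" "i < j" "j < int n - 1"
    and K: "K = complex_image (circular_permutation n c) (K5_complex n i j)"
    using assms unfolding in_K5_family_def by blast
  have n1: "n \<ge> 1" using n by simp
  note sc5 = simplicial_complex_on_K5_complex[OF ij]
  have unrotated: "complex_image (circular_permutation n (- c)) K = K5_complex n i j"
    unfolding K using complex_image_inverse[OF n1] sc5 by (simp add: simplicial_complex_on_def)
  have "\<not> generates (positions n) K' (Mon n)" if sc: "simplicial_complex_on (positions n) K'" and sub: "K' \<subset> K" for K'
  proof
    assume gen: "generates (positions n) K' (Mon n)"
    define L where "L = complex_image (circular_permutation n (- c)) K'"
    have "L \<subseteq> K5_complex n i j" unfolding L_def unrotated[symmetric] using sub by (auto simp: complex_image_def)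
    then have "L = K5_complex n i j"
      using generating_subcomplex_of_K5_complex[OF ij] generates_circular_permutation[OF gen n1]
        simplicial_complex_on_image[OF n1 sc] unfolding L_def by blast
    then have "K' = K"
      using complex_image_inverse[OF n1, of K' "- c"] sc by (simp add: K L_def simplicial_complex_on_def)
    then show False using sub by simp
  qed
  then show "minimal_generating (positions n) K (Mon n)"
    unfolding minimal_generating_def K
    using generates_circular_permutation[OF generates_K5_complex[OF ij] n1] simplicial_complex_on_image[OF n1 sc5]
    by blast
  have zero: "0 \<in> positions n" using n by (simp add: positions_def)
  show "\<exists>!p. p \<in> positions n \<and> positions n - {p} \<in> K"
  proof (intro ex1I conjI; (elim conjE)?)
    show "circular_permutation n c 0 \<in> positions n" by (rule circular_permutation_positions(1)[OF n1 zero])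
    show "positions n - {circular_permutation n c 0} \<in> K"
      unfolding K using singleton_complement_K5_complex[OF ij zero]
      by (intro singleton_complement_image[OF n1 zero]) simp
  next
    fix q assume q: "q \<in> positions n" "positions n - {q} \<in> K"
    have "positions n - {circular_permutation n (- c) q} \<in> K5_complex n i j"
      using singleton_complement_image[OF n1 q, of "- c"] by (simp add: unrotated)
    then have "circular_permutation n (- c) q = 0"
      using singleton_complement_K5_complex[OF ij circular_permutation_positions(1)[OF n1 q(1)]] by blast
    then show "q = circular_permutation n c 0"
      using circular_permutation_positions(2)[OF n1 q(1), of "- c"] by simp
  qed
qed

text \<open>No position is constant on \<open>Mon n\<close>, so each reads some source. This settles
  \<open>n = 2\<close>, where both singletons are 1-intervals.\<close>

lemma vertices_of_generating:
  assumes gen: "generates (positions n) K (Mon n)" and sc: "simplicial_complex_on (positions n) K"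
    and p: "p \<in> positions n"
  shows "{p} \<in> K"
proof -
  obtain J W and f :: "(nat \<Rightarrow> nat) \<Rightarrow> int \<Rightarrow> nat" where fin: "finite J" and WJ: "\<forall>p. W p \<subseteq> J"
    and rf: "range f = Mon n" and D: "\<forall>p x y. (\<forall>s\<in>W p. x s = y s) \<longrightarrow> f x p = f y p"
    and out: "\<forall>s. {p \<in> positions n. s \<in> W p} \<in> K"
    using generates_MonE[OF gen sc] by blast
  have "W p \<noteq> {}"
  proof
    assume "W p = {}"
    have "step_word n False p \<in> range f" "step_word n True p \<in> range f"
      using rf step_word_Mon by auto
    then obtain x y where "f x = step_word n False p" "f y = step_word n True p" by (metis imageE)
    moreover have "f x p = f y p" using D \<open>W p = {}\<close> by blast
    ultimately show False using p by (simp add: step_word_def)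
  qed
  then obtain s where "s \<in> W p" by blast
  then have "{p} \<subseteq> {p \<in> positions n. s \<in> W p}" using p by blast
  then show ?thesis using sc out unfolding simplicial_complex_on_def by blast
qed

theorem theorem6p6:
  fixes n :: nat and K :: "int set set"
  assumes "n \<ge> 1" and "simplicial_complex_on (positions n) K"
  shows "minimal_generating (positions n) K (Mon n) \<and>
           (\<exists>!S. S \<in> K \<and> is_k_interval n (n - 1) S)
         \<longleftrightarrow> in_K5_family n K"
proof
  assume L: "minimal_generating (positions n) K (Mon n) \<and> (\<exists>!S. S \<in> K \<and> is_k_interval n (n - 1) S)"
  \<comment> \<open>Intervals are nonempty, so there is no 0-interval.\<close>
  have "n \<noteq> 1"
  proof
    assume "n = 1"
    then obtain a b where "card (cyclic_interval 1 a b) = 0" using L by (auto simp: is_k_interval_def)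
    then show False using card_cyclic_interval[of 1 a b] by simp
  qed
  then have n2: "n \<ge> 2" using assms(1) by simp
  have ex1: "\<exists>!p. p \<in> positions n \<and> positions n - {p} \<in> K" using L unfolding unique_pred_interval[OF n2] by (rule conjunct2)
  have "n \<noteq> 2"
  proof
    assume n: "n = 2"
    then have pos: "positions n = {0, 1}" by (auto simp: positions_def)
    have "{q} \<in> K" if "q \<in> {0, 1}" for q
      using vertices_of_generating[of n K q] L that unfolding pos by (auto simp: minimal_generating_def)
    moreover have "positions n - {0} = {1}" "positions n - {1} = {0}" by (auto simp: pos)
    ultimately show False using ex1 unfolding pos by (metis insertI1 insertI2 zero_neq_one)
  qed
  then show "in_K5_family n K" using minimal_in_K5_family[of n K] L ex1 n2 by simp
next
  assume R: "in_K5_family n K"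
  then have n2: "n \<ge> 2" by (simp add: in_K5_family_def)
  show "minimal_generating (positions n) K (Mon n) \<and> (\<exists>!S. S \<in> K \<and> is_k_interval n (n - 1) S)"
    unfolding unique_pred_interval[OF n2] by (intro conjI K5_family_minimal[OF R])
qed

end
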